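(* Consider the nonlinear error dynamics $e_{k+1} = f(e_k,v_k) + w_k$, $k\in\mathbb{N}$, with $f(e,v)=Ae+B(\varphi(Ke+v)-v)$ and nominal inputs $v_k\in\mathcal{U}$, and let $e_0=0$. Suppose there exist a Lyapunov function $V:\mathbb{R}^n\to\mathbb{R}_{\ge 0}$ with $V(0)=0$, $V(e)>0$ for all $e\neq 0$, and $V(e)\to\infty$ as $\|e\|\to\infty$, and constants $\lambda\in(0,1)$ and $\beta>0$ such that the conditional expectation satisfies, for all $j=1,\dots,3^m$, $$\mathbb{E}_w\left[V\left(f_j(e,v)+w\right)\right]\le \lambda V(e)+\beta,\qquad \forall (e,v)\in\mathcal{S}_j.$$ Then the sublevel set $$\mathcal{R}_k^\varepsilon=\left\{e\in\mathbb{R}^n \;\middle|\; V(e)\le \frac{1-\lambda^k}{\varepsilon(1-\lambda)}\,\beta\right\}$$ is a $k$-step probabilistic reachable set (PRS) with violation level $\varepsilon$ for the stochastic process $\{e_k\}_{k\ge 0}$. Similarly, the sublevel set $$\mathcal{R}^\varepsilon=\left\{e\in\mathbb{R}^n \;\middle|\; V(e)\le \frac{\beta}{\varepsilon(1-\lambda)}+\zeta\right\},$$ with $\zeta>0$, is a probabilistic ultimate bound (PUB) with violation level $\varepsilon$ for the stochastic process $\{e_k\}_{k\ge 0}$.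
   Context: System data: $A\in\mathbb{R}^{n\times n}$ is a known Schur-stable matrix, $B\in\mathbb{R}^{n\times m}$ is a known matrix, and $K\in\mathbb{R}^{m\times n}$ is a fixed linear feedback gain with $i$-th row $K_i$. The admissible input set is $\mathcal{U}=\{u\in\mathbb{R}^m \mid \|u\|_\infty\le 1\}$. The saturation $\varphi:\mathbb{R}^m\to\mathbb{R}^m$ acts componentwise with bounds $\pm 1$, i.e. its $i$-th component is $\max(-1,\min(1,u_i))$. The error $e_k=x_k-z_k$ is the deviation between the state of the saturated system $x_{k+1}=Ax_k+B\varphi(v_k+Ke_k)+w_k$ and the nominal state $z_{k+1}=Az_k+Bv_k$, where $v_k$ is the nominal control input produced by a nominal model predictive controller and satisfies $v_k\in\mathcal{U}$. Disturbance: the process $w_k\sim\mathbb{P}_w$ in $\mathbb{R}^n$ is i.i.d. with $\mathbb{E}[w_k]=0$, and $\mathbb{P}_w$ admits finite moments up to the required degree (its support may be unbounded). $\mathbb{E}_w$ denotes expectation over $w\sim\mathbb{P}_w$ with $(e,v)$ fixed. The violation level is $\varepsilon\in(0,1)$. Saturation regions: index by $j=1,\dots,3^m$ the vectors $\Xi_j=(\xi_1,\dots,\xi_m)^\top\in\{-1,0,1\}^m$. The region $\mathcal{S}_j\subset\mathbb{R}^{n}\times\mathbb{R}^m$ is the set of $(e,v)$ such that $v\in\mathcal{U}$ and, for every $i=1,\dots,m$: $K_ie+v_i\ge 1$ if $\xi_i=1$; $-1\le K_ie+v_i\le 1$ if $\xi_i=0$; $K_ie+v_i\le -1$ if $\xi_i=-1$.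 These regions cover $\mathbb{R}^n\times\mathcal{U}$ and have mutually disjoint interiors. Set $D_j=\operatorname{diag}(\mathbf{1}_m-|\Xi_j|)$ (absolute value componentwise, $\mathbf{1}_m$ the vector of ones), let $I_m$ be the identity matrix, and let $d(\Xi_j)\in\mathbb{R}^m$ have entries $d_i(\Xi_j)=\xi_i$. Define $$f_j(e,v)=(A+BD_jK)e+B(D_j-I_m)v+B\,d(\Xi_j).$$ Then $f(e,v)=f_j(e,v)$ for all $(e,v)\in\mathcal{S}_j$. Definitions. The process $e_k$ with $e_0=0$ admits the set $\mathcal{R}_k^\varepsilon$ as a $k$-step probabilistic reachable set (PRS) with violation level $\varepsilon\in(0,1)$ if $\Pr\{e_k\in\mathcal{R}_k^\varepsilon\}\ge 1-\varepsilon$. The stochastic process $e_k$ admits the set $\mathcal{R}^\varepsilon$ as a probabilistic ultimate bound (PUB) with violation level $\varepsilon\in(0,1)$ if, for every initial condition $e_0\in\mathbb{R}^n$, there exists a finite time $t(e_0)$ such that $\Pr\{e_k\in\mathcal{R}^\varepsilon\}\ge 1-\varepsilon$ for all $k\ge t(e_0)$. *)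

theory Defs
  imports "HOL-Probability.Probability"
begin

definition schur_stable :: "real^'n^'n \<Rightarrow> bool" where
  "schur_stable A \<longleftrightarrow>
     (\<forall>(c::complex) x. x \<noteq> 0 \<and> map_matrix complex_of_real A *v x = c *s x \<longrightarrow> cmod c < 1)"

definition input_set :: "(real^'m) set" where
  "input_set = {u. infnorm u \<le> 1}"

definition sat :: "real^'m \<Rightarrow> real^'m" where
  "sat u = (\<chi> i. max (-1) (min 1 (u $ i)))"

definition err_map ::
    "real^'n^'n \<Rightarrow> real^'m^'n \<Rightarrow> real^'n^'m \<Rightarrow> real^'n \<Rightarrow> real^'m \<Rightarrow> real^'n" where
  "err_map A B K e v = A *v e + B *v (sat (K *v e + v) - v)"

text \<open>The saturation regions are indexed directly by the \<open>3^m\<close> sign vectors, and a sign vector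
  \<open>\<xi>\<close> also serves as the offset \<open>d(\<xi>)\<close>, whose entries are those of \<open>\<xi>\<close>.\<close>

definition sat_patterns :: "(real^'m) set" where
  "sat_patterns = {\<xi>. \<forall>i. \<xi> $ i \<in> {-1, 0, 1}}"

definition sat_region :: "real^'n^'m \<Rightarrow> real^'m \<Rightarrow> ((real^'n) \<times> (real^'m)) set" where
  "sat_region K \<xi> = {(e, v). v \<in> input_set \<and>
     (\<forall>i. (\<xi> $ i = 1 \<longrightarrow> (K *v e) $ i + v $ i \<ge> 1) \<and>
          (\<xi> $ i = 0 \<longrightarrow> -1 \<le> (K *v e) $ i + v $ i \<and> (K *v e) $ i + v $ i \<le> 1) \<and>
          (\<xi> $ i = -1 \<longrightarrow> (K *v e) $ i + v $ i \<le> -1))}"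

definition sat_diag :: "real^'m \<Rightarrow> real^'m^'m" where
  "sat_diag \<xi> = (\<chi> i j. if i = j then 1 - \<bar>\<xi> $ i\<bar> else 0)"

definition affine_map ::
    "real^'n^'n \<Rightarrow> real^'m^'n \<Rightarrow> real^'n^'m \<Rightarrow> real^'m \<Rightarrow> real^'n \<Rightarrow> real^'m \<Rightarrow> real^'n" where
  "affine_map A B K \<xi> e v =
     (A + B ** sat_diag \<xi> ** K) *v e + (B ** (sat_diag \<xi> - mat 1)) *v v + B *v \<xi>"

lemma sat_regions_cover:
  fixes K :: "real^'n^'m"
  assumes "v \<in> input_set"
  shows "\<exists>\<xi>\<in>sat_patterns. (e, v) \<in> sat_region K \<xi>"
proof -
  let ?y = "\<lambda>i. (K *v e) $ i + v $ i"
  define \<xi> :: "real^'m" where "\<xi> = (\<chi> i. if ?y i \<ge> 1 then 1 else if ?y i \<le> -1 then -1 else 0)"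
  have "\<xi> \<in> sat_patterns" by (simp add: sat_patterns_def \<xi>_def)
  moreover have "(e, v) \<in> sat_region K \<xi>"
    using assms by (auto simp: sat_region_def \<xi>_def)
  ultimately show ?thesis by blast
qed

lemma err_map_eq_affine_map:
  assumes "\<xi> \<in> sat_patterns" "(e, v) \<in> sat_region K \<xi>"
  shows "err_map A B K e v = affine_map A B K \<xi> e v"
proof -
  have diag: "(sat_diag \<xi> *v u) $ i = (1 - \<bar>\<xi> $ i\<bar>) * u $ i" for u i
    unfolding sat_diag_def matrix_vector_mult_def
    by (simp add: if_distrib[where f="\<lambda>c. c * _"] sum.delta cong: if_cong)
  have "sat (K *v e + v) = sat_diag \<xi> *v (K *v e + v) + \<xi>"
  proof (subst vec_eq_iff, rule allI)
    fix i
    have "\<xi> $ i = -1 \<or> \<xi> $ i = 0 \<or> \<xi> $ i = 1" using assms(1) by (auto simp: sat_patterns_def)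
    then show "sat (K *v e + v) $ i = (sat_diag \<xi> *v (K *v e + v) + \<xi>) $ i"
      using assms(2) by (auto simp: diag sat_def sat_region_def vector_add_component)
  qed
  then show ?thesis
    unfolding err_map_def affine_map_def
    by (simp add: matrix_vector_mult_add_rdistrib matrix_vector_mult_diff_rdistrib
        matrix_vector_right_distrib matrix_vector_mult_diff_distrib
        matrix_vector_mul_assoc[symmetric] algebra_simps)
qed

text \<open>\<open>err_proc A B K v w e0\<close> is the error process started from the deterministic initial error
  \<open>e0\<close>.\<close>

fun err_proc ::
    "real^'n^'n \<Rightarrow> real^'m^'n \<Rightarrow> real^'n^'m \<Rightarrow> (nat \<Rightarrow> 'a \<Rightarrow> real^'m) \<Rightarrow> (nat \<Rightarrow> 'a \<Rightarrow> real^'n)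
      \<Rightarrow> real^'n \<Rightarrow> nat \<Rightarrow> 'a \<Rightarrow> real^'n" where
  "err_proc A B K v w e0 0 \<omega> = e0"
| "err_proc A B K v w e0 (Suc k) \<omega> =
     err_map A B K (err_proc A B K v w e0 k \<omega>) (v k \<omega>) + w k \<omega>"

definition iid :: "'a measure \<Rightarrow> 'b measure \<Rightarrow> 'b measure \<Rightarrow> (nat \<Rightarrow> 'a \<Rightarrow> 'b) \<Rightarrow> bool" where
  "iid M N P w \<longleftrightarrow> prob_space.indep_vars M (\<lambda>_. N) w UNIV \<and> (\<forall>k. distr M N (w k) = P)"

text \<open>Causality of the inputs with respect to a flow of information \<open>F\<close>: at time \<open>k\<close> the past
  disturbances and the inputs up to and including \<open>v k\<close> are known, whereas \<open>w k\<close> is independent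
  of everything known. Every deterministic input sequence is causal for the filtration generated by
  an i.i.d. disturbance.\<close>

definition causal_input ::
    "'a measure \<Rightarrow> (nat \<Rightarrow> 'a measure) \<Rightarrow> (nat \<Rightarrow> 'a \<Rightarrow> real^'n) \<Rightarrow> (nat \<Rightarrow> 'a \<Rightarrow> real^'m) \<Rightarrow> bool" where
  "causal_input M F w v \<longleftrightarrow>
     filtration (space M) F \<and> (\<forall>k. subalgebra M (F k)) \<and>
     (\<forall>k. v k \<in> F k \<rightarrow>\<^sub>M borel) \<and>
     (\<forall>k. w k \<in> F (Suc k) \<rightarrow>\<^sub>M borel) \<and>
     (\<forall>k. prob_space.indep_set M (sets (F k)) (sets (vimage_algebra (space M) (w k) borel)))"

text \<open>In the next two definitions \<open>E e0 k\<close> is the state at time \<open>k\<close> of the process started from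
  \<open>e0\<close>.\<close>

definition k_step_PRS ::
    "'a measure \<Rightarrow> ('b::zero \<Rightarrow> nat \<Rightarrow> 'a \<Rightarrow> 'b) \<Rightarrow> nat \<Rightarrow> 'b set \<Rightarrow> real \<Rightarrow> bool" where
  "k_step_PRS M E k R \<epsilon> \<longleftrightarrow> measure M {\<omega> \<in> space M. E 0 k \<omega> \<in> R} \<ge> 1 - \<epsilon>"

definition PUB :: "'a measure \<Rightarrow> ('b \<Rightarrow> nat \<Rightarrow> 'a \<Rightarrow> 'b) \<Rightarrow> 'b set \<Rightarrow> real \<Rightarrow> bool" where
  "PUB M E R \<epsilon> \<longleftrightarrow>
     (\<forall>e0. \<exists>t. \<forall>k\<ge>t. measure M {\<omega> \<in> space M. E e0 k \<omega> \<in> R} \<ge> 1 - \<epsilon>)"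

end

theory Submission
  imports Defs
begin

text \<open>The regional drift conditions paste together to one condition on the saturated map itself:
  the regions cover all errors and admissible inputs, and on each of them \<^const>\<open>err_map\<close> is the
  affine map of that region (\<open>drift_err_map\<close>). The error \<open>e\<^sub>k\<close> and the input \<open>v\<^sub>k\<close> are functions of
  the information at time \<open>k\<close>, of which \<open>w\<^sub>k\<close> is independent. Hence \<open>w\<^sub>k\<close> may be integrated out first,
  for fixed \<open>e\<^sub>k\<close> and \<open>v\<^sub>k\<close> (\<open>nn_integral_indep_var\<close>), and the drift condition gives
  \<open>E V(e\<^sub>k\<^sub>+\<^sub>1) \<le> \<lambda> E V(e\<^sub>k) + \<beta>\<close>. Unrolling this recursion bounds the mean of \<open>V(e\<^sub>k)\<close>
  by \<open>\<lambda>\<^sup>k V(e\<^sub>0) + (1 - \<lambda>\<^sup>k) \<beta> / (1 - \<lambda>)\<close> (\<open>nn_integral_V_err_proc_le\<close>).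

  Markov's inequality turns a bound \<open>\<epsilon> c\<close> on the mean into probability at least \<open>1 - \<epsilon>\<close> for the
  sublevel set at level \<open>c\<close>. If \<open>e\<^sub>0 = 0\<close>, the initial term vanishes and the level is the one of the
  reachable set. For any other \<open>e\<^sub>0\<close>, the initial term decays, and the ultimate bound
  holds from the moment on at which it has dropped below \<open>\<epsilon> \<zeta>\<close>.\<close>

section \<open>Integrating out an independent variable\<close>

text \<open>Independence of \<open>Y\<close> from all the information \<open>G\<close> passes to any \<open>X\<close> determined by it, since the
  events of \<open>X\<close> lie in \<open>G\<close>. This extracts from \<^const>\<open>causal_input\<close> the independence of a
  disturbance from the noise-free part of the next error.\<close>

lemma (in prob_space) indep_var_subalgebraI:
  assumes sub: "subalgebra M G" and X: "X \<in> G \<rightarrow>\<^sub>M S" and Y: "Y \<in> M \<rightarrow>\<^sub>M T"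
    and ind: "indep_set (sets G) (sets (vimage_algebra (space M) Y T))"
  shows "indep_var S X T Y"
proof -
  have sp: "space G = space M" using sub by (simp add: subalgebra_def)
  have X_sets: "sigma_sets (space M) {X -` A \<inter> space M |A. A \<in> sets S} \<subseteq> sets G"
    using X sp sets.sigma_sets_subset[of "{X -` A \<inter> space M |A. A \<in> sets S}" G]
    by (auto simp: measurable_def)
  have "indep_set (sigma_sets (space M) {X -` A \<inter> space M |A. A \<in> sets S})
      (sigma_sets (space M) {Y -` A \<inter> space M |A. A \<in> sets T})"
    using ind X_sets unfolding indep_sets2_eq sets_vimage_algebra by blast
  moreover have "X \<in> M \<rightarrow>\<^sub>M S"
    using X sub by (auto simp: measurable_def subalgebra_def)
  ultimately show ?thesis using Y by (simp add: indep_var_eq)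
qed

text \<open>The joint law of \<open>X\<close> and \<open>Y\<close> is the product of their laws, so Tonelli applies. This plays the
  role of conditioning on \<open>X\<close>.\<close>

lemma (in prob_space) nn_integral_indep_var:
  assumes ind: "indep_var S X T Y" and f [measurable]: "f \<in> borel_measurable (S \<Otimes>\<^sub>M T)"
  shows "(\<integral>\<^sup>+ \<omega>. f (X \<omega>, Y \<omega>) \<partial>M) = (\<integral>\<^sup>+ \<omega>. (\<integral>\<^sup>+ y. f (X \<omega>, y) \<partial>distr M T Y) \<partial>M)"
proof -
  have X [measurable]: "X \<in> M \<rightarrow>\<^sub>M S" and Y [measurable]: "Y \<in> M \<rightarrow>\<^sub>M T"
    using ind by (auto dest: indep_var_rv1 indep_var_rv2)
  interpret D: prob_space "distr M T Y" by (rule prob_space_distr) (fact Y)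
  have "(\<integral>\<^sup>+ \<omega>. f (X \<omega>, Y \<omega>) \<partial>M)
      = (\<integral>\<^sup>+ z. f z \<partial>distr M (S \<Otimes>\<^sub>M T) (\<lambda>\<omega>. (X \<omega>, Y \<omega>)))"
    by (simp add: nn_integral_distr)
  also have "\<dots> = (\<integral>\<^sup>+ z. f z \<partial>(distr M S X \<Otimes>\<^sub>M distr M T Y))"
    using ind by (simp add: indep_var_distribution_eq)
  also have "\<dots> = (\<integral>\<^sup>+ x. (\<integral>\<^sup>+ y. f (x, y) \<partial>distr M T Y) \<partial>distr M S X)"
    by (rule D.nn_integral_fst[symmetric]) measurable
  also have "\<dots> = (\<integral>\<^sup>+ \<omega>. (\<integral>\<^sup>+ y. f (X \<omega>, y) \<partial>distr M T Y) \<partial>M)"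
    by (rule nn_integral_distr) measurable
  finally show ?thesis .
qed

section \<open>From a bound on the mean to a sublevel set\<close>

lemma (in prob_space) prob_le_ge_of_nn_integral_le:
  fixes X :: "'a \<Rightarrow> real"
  assumes X [measurable]: "X \<in> borel_measurable M" and nn: "\<And>\<omega>. 0 \<le> X \<omega>"
    and c: "0 < c" and \<epsilon>: "0 \<le> \<epsilon>"
    and mean: "(\<integral>\<^sup>+ \<omega>. ennreal (X \<omega>) \<partial>M) \<le> ennreal (\<epsilon> * c)"
  shows "1 - \<epsilon> \<le> prob {\<omega> \<in> space M. X \<omega> \<le> c}"
proof -
  have fin: "(\<integral>\<^sup>+ \<omega>. ennreal (X \<omega>) \<partial>M) < \<infinity>"
    using mean by (simp add: le_less_trans)
  have int: "integrable M X"
    using fin nn by (simp add: integrable_iff_bounded)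
  have "ennreal (\<integral>\<omega>. X \<omega> \<partial>M) \<le> ennreal (\<epsilon> * c)"
    using mean nn int by (simp add: nn_integral_eq_integral)
  then have "(\<integral>\<omega>. X \<omega> \<partial>M) \<le> \<epsilon> * c"
    using c \<epsilon> by simp
  then have "(\<integral>\<omega>. X \<omega> \<partial>M) / c \<le> \<epsilon>"
    using c by (simp add: field_simps)
  moreover have "prob {\<omega> \<in> space M. c \<le> X \<omega>} \<le> (\<integral>\<omega>. X \<omega> \<partial>M) / c"
    using integral_Markov_inequality_measure[OF int, of "{}" c] nn c by simp
  moreover have "prob {\<omega> \<in> space M. \<not> X \<omega> \<le> c} \<le> prob {\<omega> \<in> space M. c \<le> X \<omega>}"
    by (rule finite_measure_mono) auto
  moreover have "prob {\<omega> \<in> space M. \<not> X \<omega> \<le> c} = 1 - prob {\<omega> \<in> space M. X \<omega> \<le> c}"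
    by (rule prob_neg) simp
  ultimately show ?thesis by simp
qed

text \<open>The recursion is over the
  extended nonnegative reals, so that the means in question need not be known to be finite in
  advance.\<close>

lemma affine_recursion_le:
  fixes a :: "nat \<Rightarrow> ennreal"
  assumes lam: "0 \<le> lam" "lam < 1" and \<beta>: "0 \<le> \<beta>" and c: "0 \<le> c"
    and a0: "a 0 \<le> ennreal c"
    and step: "\<And>k. a (Suc k) \<le> ennreal lam * a k + ennreal \<beta>"
  shows "a k \<le> ennreal (lam ^ k * c + (1 - lam ^ k) / (1 - lam) * \<beta>)"
proof (induction k)
  case 0
  then show ?case using a0 by simp
next
  case (Suc k)
  let ?b = "lam ^ k * c + (1 - lam ^ k) / (1 - lam) * \<beta>"
  have "lam ^ k \<le> 1" using lam by (simp add: power_le_one)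
  then have b: "0 \<le> ?b" using lam \<beta> c by simp
  have "a (Suc k) \<le> ennreal lam * ennreal ?b + ennreal \<beta>"
    using step[of k] Suc by (meson add_right_mono mult_left_mono order_trans zero_le)
  also have "\<dots> = ennreal (lam * ?b + \<beta>)"
    using lam \<beta> b by (simp add: ennreal_mult ennreal_plus)
  also have "lam * ?b + \<beta> = lam ^ Suc k * c + (1 - lam ^ Suc k) / (1 - lam) * \<beta>"
    using lam by (simp add: field_simps)
  finally show ?case .
qed

section \<open>The saturated error process\<close>

lemma continuous_on_err_map:
  "continuous_on UNIV (\<lambda>p. err_map A B K (fst p) (snd p))"
proof -
  have mult: "continuous_on UNIV (\<lambda>p. C *v g p)" if "continuous_on UNIV g"
    for C :: "real^'x^'y" and g :: "'z::topological_space \<Rightarrow> real^'x"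
    using continuous_on_compose2[OF matrix_vector_mult_linear_continuous_on that] by blast
  show ?thesis
    unfolding err_map_def sat_def
    by (intro continuous_intros mult continuous_on_vec_lambda continuous_on_max continuous_on_min)
qed

lemma err_proc_adapted:
  assumes "causal_input M F w v"
  shows "err_proc A B K v w e0 k \<in> F k \<rightarrow>\<^sub>M borel"
proof (induction k)
  case 0
  have "err_proc A B K v w e0 0 = (\<lambda>_. e0)" by (rule ext) simp
  then show ?case by simp
next
  case (Suc k)
  have F: "space (F (Suc k)) = space (F k)" "sets (F k) \<subseteq> sets (F (Suc k))"
    using assms unfolding causal_input_def filtration_def by auto
  have e: "err_proc A B K v w e0 k \<in> F (Suc k) \<rightarrow>\<^sub>M borel"
    and v: "v k \<in> F (Suc k) \<rightarrow>\<^sub>M borel"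
    using Suc assms F unfolding causal_input_def by (auto simp: measurable_def)
  have w [measurable]: "w k \<in> F (Suc k) \<rightarrow>\<^sub>M borel"
    using assms unfolding causal_input_def by auto
  have [measurable]: "(\<lambda>\<omega>. err_map A B K (err_proc A B K v w e0 k \<omega>) (v k \<omega>))
      \<in> F (Suc k) \<rightarrow>\<^sub>M borel"
    by (rule borel_measurable_continuous_Pair[OF e v continuous_on_err_map])
  have "err_proc A B K v w e0 (Suc k)
      = (\<lambda>\<omega>. err_map A B K (err_proc A B K v w e0 k \<omega>) (v k \<omega>) + w k \<omega>)"
    by (rule ext) simp
  then show ?case by simp
qed

lemma drift_err_map:
  assumes drift: "\<And>\<xi> e u. \<xi> \<in> sat_patterns \<Longrightarrow> (e, u) \<in> sat_region K \<xi> \<Longrightarrow>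
      (\<integral>\<^sup>+ x. ennreal (V (affine_map A B K \<xi> e u + x)) \<partial>Pw) \<le> ennreal (lam * V e + \<beta>)"
    and u: "u \<in> input_set"
  shows "(\<integral>\<^sup>+ x. ennreal (V (err_map A B K e u + x)) \<partial>Pw) \<le> ennreal (lam * V e + \<beta>)"
proof -
  obtain \<xi> where "\<xi> \<in> sat_patterns" "(e, u) \<in> sat_region K \<xi>"
    using sat_regions_cover[OF u] by blast
  then show ?thesis using drift err_map_eq_affine_map by metis
qed

lemma nn_integral_V_err_proc_le:
  fixes A :: "real^'n^'n" and B :: "real^'m^'n" and K :: "real^'n^'m"
    and V :: "real^'n \<Rightarrow> real"
  assumes M: "prob_space M"
    and law: "\<And>k. distr M borel (w k) = Pw"
    and causal: "causal_input M F w v"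
    and v_in: "\<And>k \<omega>. \<omega> \<in> space M \<Longrightarrow> v k \<omega> \<in> input_set"
    and V [measurable]: "V \<in> borel_measurable borel" and V_nn: "\<And>e. 0 \<le> V e"
    and lam: "0 \<le> lam" "lam < 1" and \<beta>: "0 \<le> \<beta>"
    and drift: "\<And>\<xi> e u. \<xi> \<in> sat_patterns \<Longrightarrow> (e, u) \<in> sat_region K \<xi> \<Longrightarrow>
      (\<integral>\<^sup>+ x. ennreal (V (affine_map A B K \<xi> e u + x)) \<partial>Pw) \<le> ennreal (lam * V e + \<beta>)"
  shows "(\<integral>\<^sup>+ \<omega>. ennreal (V (err_proc A B K v w e0 k \<omega>)) \<partial>M)
    \<le> ennreal (lam ^ k * V e0 + (1 - lam ^ k) / (1 - lam) * \<beta>)"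
proof -
  interpret prob_space M by (fact M)
  let ?e = "err_proc A B K v w e0"
  have sub: "subalgebra M (F k)" for k
    using causal by (simp add: causal_input_def)
  have e_M [measurable]: "?e k \<in> borel_measurable M" for k
    using measurable_from_subalg[OF sub err_proc_adapted[OF causal]] .
  have step: "(\<integral>\<^sup>+ \<omega>. ennreal (V (?e (Suc k) \<omega>)) \<partial>M)
      \<le> ennreal lam * (\<integral>\<^sup>+ \<omega>. ennreal (V (?e k \<omega>)) \<partial>M) + ennreal \<beta>" for k
  proof -
    let ?X = "\<lambda>\<omega>. err_map A B K (?e k \<omega>) (v k \<omega>)"
    have v: "v k \<in> F k \<rightarrow>\<^sub>M borel" and w': "w k \<in> F (Suc k) \<rightarrow>\<^sub>M borel"
      and ind: "indep_set (sets (F k)) (sets (vimage_algebra (space M) (w k) borel))"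
      using causal by (simp_all add: causal_input_def)
    have X: "?X \<in> F k \<rightarrow>\<^sub>M borel"
      by (rule borel_measurable_continuous_Pair[OF err_proc_adapted[OF causal] v
            continuous_on_err_map])
    have indep: "indep_var borel ?X borel (w k)"
      using indep_var_subalgebraI[OF sub X measurable_from_subalg[OF sub w'] ind] .
    have "(\<integral>\<^sup>+ \<omega>. ennreal (V (?e (Suc k) \<omega>)) \<partial>M)
        = (\<integral>\<^sup>+ \<omega>. (\<integral>\<^sup>+ x. ennreal (V (?X \<omega> + x)) \<partial>Pw) \<partial>M)"
      using nn_integral_indep_var[OF indep, of "\<lambda>(a, x). ennreal (V (a + x))"]
      by (simp add: law)
    also have "\<dots> \<le> (\<integral>\<^sup>+ \<omega>. ennreal (lam * V (?e k \<omega>) + \<beta>) \<partial>M)"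
      by (intro nn_integral_mono drift_err_map[OF drift] v_in)
    also have "\<dots> = (\<integral>\<^sup>+ \<omega>. (ennreal lam * ennreal (V (?e k \<omega>)) + ennreal \<beta>) \<partial>M)"
      using lam \<beta> V_nn by (simp add: ennreal_plus ennreal_mult)
    also have "\<dots> = ennreal lam * (\<integral>\<^sup>+ \<omega>. ennreal (V (?e k \<omega>)) \<partial>M) + ennreal \<beta>"
      by (simp add: nn_integral_add nn_integral_cmult emeasure_space_1)
    finally show ?thesis .
  qed
  have init: "(\<integral>\<^sup>+ \<omega>. ennreal (V (?e 0 \<omega>)) \<partial>M) \<le> ennreal (V e0)"
    by (simp add: emeasure_space_1)
  show ?thesis
    using affine_recursion_le[OF lam \<beta> V_nn init step] .
qed

theorem theorem1:
  fixes A :: "real^'n^'n" and B :: "real^'m^'n" and K :: "real^'n^'m"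
    and M :: "'a measure" and F :: "nat \<Rightarrow> 'a measure"
    and w :: "nat \<Rightarrow> 'a \<Rightarrow> real^'n" and v :: "nat \<Rightarrow> 'a \<Rightarrow> real^'m"
    and Pw :: "(real^'n) measure" and d :: nat
    and V :: "real^'n \<Rightarrow> real" and lam \<beta> \<epsilon> :: real
  assumes "schur_stable A"
    and "prob_space M"
    and "iid M borel Pw w"
    and "1 \<le> d" and "\<And>q. q \<le> d \<Longrightarrow> integrable Pw (\<lambda>x. norm x ^ q)"
    and "(\<integral>x. x \<partial>Pw) = 0"
    and "causal_input M F w v"
    and "\<And>k \<omega>. \<omega> \<in> space M \<Longrightarrow> v k \<omega> \<in> input_set"
    and "0 < \<epsilon>" and "\<epsilon> < 1"
    and "V \<in> borel_measurable borel"
    and "\<And>e. 0 \<le> V e" and "V 0 = 0" and "\<And>e. e \<noteq> 0 \<Longrightarrow> 0 < V e"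
    and "filterlim V at_top at_infinity"
    and "0 < lam" and "lam < 1" and "0 < \<beta>"
    and "\<And>\<xi> e u. \<xi> \<in> sat_patterns \<Longrightarrow> (e, u) \<in> sat_region K \<xi> \<Longrightarrow>
           (\<integral>\<^sup>+ x. ennreal (V (affine_map A B K \<xi> e u + x)) \<partial>Pw) \<le> ennreal (lam * V e + \<beta>)"
  shows "(\<forall>k. k_step_PRS M (err_proc A B K v w) k
                {e. V e \<le> (1 - lam ^ k) / (\<epsilon> * (1 - lam)) * \<beta>} \<epsilon>) \<and>
         (\<forall>\<zeta>>0. PUB M (err_proc A B K v w) {e. V e \<le> \<beta> / (\<epsilon> * (1 - lam)) + \<zeta>} \<epsilon>)"
proof -
  interpret prob_space M by fact
  let ?e = "err_proc A B K v w"
  note V = \<open>V \<in> borel_measurable borel\<close> and V_nn = \<open>\<And>e. 0 \<le> V e\<close>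
  have law: "distr M borel (w k) = Pw" for k
    using \<open>iid M borel Pw w\<close> by (simp add: iid_def)
  have e_meas: "?e e0 k \<in> borel_measurable M" for e0 k
  proof (rule measurable_from_subalg)
    show "subalgebra M (F k)" using \<open>causal_input M F w v\<close> by (simp add: causal_input_def)
    show "?e e0 k \<in> borel_measurable (F k)" by (rule err_proc_adapted) fact
  qed
  have mean: "(\<integral>\<^sup>+ \<omega>. ennreal (V (?e e0 k \<omega>)) \<partial>M)
      \<le> ennreal (lam ^ k * V e0 + (1 - lam ^ k) / (1 - lam) * \<beta>)" for e0 k
    by (rule nn_integral_V_err_proc_le[where F = F and Pw = Pw]) (use assms law in auto)
  have sublevel: "1 - \<epsilon> \<le> prob {\<omega> \<in> space M. ?e e0 k \<omega> \<in> {e. V e \<le> c}}"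
    if "0 < c" and "lam ^ k * V e0 + (1 - lam ^ k) / (1 - lam) * \<beta> \<le> \<epsilon> * c" for e0 k c
    using prob_le_ge_of_nn_integral_le[OF measurable_compose[OF e_meas V] V_nn that(1),
        of \<epsilon> e0 k] order_trans[OF mean ennreal_leI[OF that(2)]] \<open>0 < \<epsilon>\<close>
    by simp
  have "k_step_PRS M ?e k {e. V e \<le> (1 - lam ^ k) / (\<epsilon> * (1 - lam)) * \<beta>} \<epsilon>" for k
  proof (cases k)
    case 0
    \<comment> \<open>Here the level is \<open>0\<close>, which Markov's inequality does not cover; but \<open>e\<^sub>0 = 0\<close> surely.\<close>
    then show ?thesis
      using \<open>V 0 = 0\<close> \<open>0 < \<epsilon>\<close> by (simp add: k_step_PRS_def prob_space)
  next
    case (Suc j)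
    then have "lam ^ k < 1"
      using \<open>0 < lam\<close> \<open>lam < 1\<close> power_Suc_less_one[of lam j] by simp
    then show ?thesis
      unfolding k_step_PRS_def
      using \<open>0 < \<epsilon>\<close> \<open>lam < 1\<close> \<open>0 < \<beta>\<close> \<open>V 0 = 0\<close> by (intro sublevel) auto
  qed
  moreover have "PUB M ?e {e. V e \<le> \<beta> / (\<epsilon> * (1 - lam)) + \<zeta>} \<epsilon>" if \<zeta>: "0 < \<zeta>" for \<zeta>
    unfolding PUB_def
  proof
    fix e0
    have "(\<lambda>k. lam ^ k * V e0) \<longlonglongrightarrow> 0 * V e0"
      using \<open>0 < lam\<close> \<open>lam < 1\<close> by (intro tendsto_intros LIMSEQ_realpow_zero) auto
    then have "eventually (\<lambda>k. lam ^ k * V e0 < \<epsilon> * \<zeta>) sequentially"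
      using \<zeta> \<open>0 < \<epsilon>\<close> by (intro order_tendstoD(2)) auto
    then obtain t where t: "\<And>k. t \<le> k \<Longrightarrow> lam ^ k * V e0 < \<epsilon> * \<zeta>"
      unfolding eventually_sequentially by blast
    have "1 - \<epsilon> \<le> prob {\<omega> \<in> space M. ?e e0 k \<omega> \<in> {e. V e \<le> \<beta> / (\<epsilon> * (1 - lam)) + \<zeta>}}"
      if k: "t \<le> k" for k
    proof (rule sublevel)
      show "0 < \<beta> / (\<epsilon> * (1 - lam)) + \<zeta>"
        using \<zeta> \<open>0 < \<epsilon>\<close> \<open>lam < 1\<close> \<open>0 < \<beta>\<close> by (simp add: add_pos_pos)
      have "(1 - lam ^ k) / (1 - lam) * \<beta> \<le> 1 / (1 - lam) * \<beta>"
        using \<open>0 < lam\<close> \<open>lam < 1\<close> \<open>0 < \<beta>\<close> by (intro mult_right_mono divide_right_mono) auto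
      then have "lam ^ k * V e0 + (1 - lam ^ k) / (1 - lam) * \<beta> \<le> \<epsilon> * \<zeta> + 1 / (1 - lam) * \<beta>"
        using t[OF k] by linarith
      also have "\<dots> = \<epsilon> * (\<beta> / (\<epsilon> * (1 - lam)) + \<zeta>)"
        using \<open>0 < \<epsilon>\<close> \<open>lam < 1\<close> by (simp add: field_simps)
      finally show "lam ^ k * V e0 + (1 - lam ^ k) / (1 - lam) * \<beta>
          \<le> \<epsilon> * (\<beta> / (\<epsilon> * (1 - lam)) + \<zeta>)" .
    qed
    then show "\<exists>t. \<forall>k\<ge>t. 1 - \<epsilon>
        \<le> prob {\<omega> \<in> space M. ?e e0 k \<omega> \<in> {e. V e \<le> \<beta> / (\<epsilon> * (1 - lam)) + \<zeta>}}"
      by blast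
  qed
  ultimately show ?thesis by blast
qed

end
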